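(* Let $d\ge3$, let $a>1$ be a real number with $\bar a:=2a^{d-1}-a^d-1>0$, let $0<\varepsilon<\bar a$, and let $(\alpha_1,\ldots,\alpha_d)\in\mathfrak{C}(a)$ be such that the rotation $T(x_1,\ldots,x_d)=(x_1+\alpha_1,\ldots,x_d+\alpha_d)$ on $\mathbb{T}^d$ is minimal. Let $q_n^{(j)}$ denote the $n$-th continued fraction denominator of $\alpha_j$, and for $j=1,\ldots,d$ set $$f_{n,j}(x)=\frac{q_{n+1}^{(j)}}{(q_n^{(j)})^{1+\bar a-\varepsilon}}\bigl(1-\cos 2\pi q_n^{(j)}x\bigr),\qquad \varphi_j(x)=\sum_{n=1}^\infty\bigl(f_{n,j}(x+\alpha_j)-f_{n,j}(x)\bigr),$$ $$F^{(j)}=\bigcap_{n=1}^{\infty}\bigcup_{l=0}^{q^{(j)}_n-1}\left(\frac{l}{q^{(j)}_n}+\left[-\frac{1}{\sqrt{q^{(j)}_{n}q^{(j)}_{n+1}}},\frac{1}{\sqrt{q^{(j)}_{n}q^{(j)}_{n+1}}}\right]\right)\subset\mathbb{T}.$$ Then the function $\varphi:\mathbb{T}^d\to\mathbb{R}$, $\varphi(x_1,\ldots,x_d)=\varphi_1(x_1)+\cdots+\varphi_d(x_d)$, is of class $C^{\lceil\bar a-\varepsilon\rceil}$, and $\varphi^{(m)}(x_1,\ldots,x_d)\to+\infty$ as $|m|\to+\infty$ for each $(x_1,\ldots,x_d)\in F^{(1)}\times\cdots\times F^{(d)}$.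
   Context: $\mathbb{T}=\mathbb{R}/\mathbb{Z}$. For irrational $\alpha=[0;a_1,a_2,\ldots]$ the denominators are $q_{-1}=0$, $q_0=1$, $q_n=a_nq_{n-1}+q_{n-2}$ for $n\ge 1$. With $C=2\lceil 4^{a+2}\rceil$, $\mathfrak{C}(a)$ is the set of $(\alpha_1,\ldots,\alpha_d)\in\mathbb{T}^d$ with all $\alpha_j$ irrational and $4(q_n^{(j)})^a\le q_n^{(j+1)}\le C(q_n^{(j)})^a$ for all $1\le j\le d$ and $n\ge1$, where $q_n^{(d+1)}:=q_{n+1}^{(1)}$. For $m\in\mathbb{Z}$: $\varphi^{(m)}(x)=\sum_{k=0}^{m-1}\varphi(T^kx)$ for $m>0$, $\varphi^{(0)}=0$, $\varphi^{(m)}(x)=-\sum_{k=1}^{|m|}\varphi(T^{-k}x)$ for $m<0$. *)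

theory Defs
  imports "HOL-Analysis.Analysis"
begin

section \<open>The circle \<open>\<real>/\<int>\<close>: group structure and quotient topology\<close>

quotient_type circle = real / "\<lambda>x y::real. x - y \<in> \<int>"
  morphisms rep_circle to_circle
proof (rule equivpI)
  show "reflp (\<lambda>x y::real. x - y \<in> \<int>)"
    by (simp add: reflp_def)
  show "symp (\<lambda>x y::real. x - y \<in> \<int>)"
    by (rule sympI) (use Ints_minus minus_diff_eq in metis)
  show "transp (\<lambda>x y::real. x - y \<in> \<int>)"
  proof (rule transpI)
    fix x y z :: real
    assume "x - y \<in> \<int>" "y - z \<in> \<int>"
    then have "(x - y) + (y - z) \<in> \<int>"
      by (rule Ints_add)
    then show "x - z \<in> \<int>"
      by simp
  qed
qed

instantiation circle :: ab_group_add
begin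

lift_definition zero_circle :: circle is "0 :: real" .

lift_definition plus_circle :: "circle \<Rightarrow> circle \<Rightarrow> circle" is "(+) :: real \<Rightarrow> real \<Rightarrow> real"
proof -
  fix x x' y y' :: real
  assume "x - x' \<in> \<int>" "y - y' \<in> \<int>"
  then have "(x - x') + (y - y') \<in> \<int>"
    by (rule Ints_add)
  then show "x + y - (x' + y') \<in> \<int>"
    by (simp add: algebra_simps)
qed

lift_definition uminus_circle :: "circle \<Rightarrow> circle" is "uminus :: real \<Rightarrow> real"
proof -
  fix x y :: real
  assume "x - y \<in> \<int>"
  then have "- (x - y) \<in> \<int>"
    by (rule Ints_minus)
  then show "- x - - y \<in> \<int>"
    by simp
qed

lift_definition minus_circle :: "circle \<Rightarrow> circle \<Rightarrow> circle" is "(-) :: real \<Rightarrow> real \<Rightarrow> real"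
proof -
  fix x x' y y' :: real
  assume "x - x' \<in> \<int>" "y - y' \<in> \<int>"
  then have "(x - x') - (y - y') \<in> \<int>"
    by (rule Ints_diff)
  then show "x - y - (x' - y') \<in> \<int>"
    by (simp add: algebra_simps)
qed

instance
  by standard (transfer; simp)+

end

instantiation circle :: topological_space
begin

definition open_circle :: "circle set \<Rightarrow> bool" where
  "open_circle U \<longleftrightarrow> open (to_circle -` U)"

instance
  by standard (auto simp: open_circle_def vimage_Union open_Int)

end

lift_definition irrational_circle :: "circle \<Rightarrow> bool" is "\<lambda>x. x \<notin> \<rat>"
proof -
  fix x y :: real
  assume "x - y \<in> \<int>"
  then have *: "x - y \<in> \<rat>"
    using Ints_subset_Rats by blast
  show "x \<notin> \<rat> \<longleftrightarrow> y \<notin> \<rat>"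
    using Rats_add[OF *, of y] Rats_diff[OF _ *, of x] by auto
qed

text \<open>\<open>cos_circle q x\<close> is \<open>cos (2\<pi>qx)\<close>.\<close>

lift_definition cos_circle :: "nat \<Rightarrow> circle \<Rightarrow> real" is "\<lambda>q x. cos (2 * pi * real q * x)"
proof -
  fix q :: nat and x y :: real
  assume "x - y \<in> \<int>"
  then obtain k :: int where "x = y + of_int k"
    by (metis Ints_cases add.commute diff_add_cancel)
  then have "2 * pi * real q * x = 2 * pi * real q * y + 2 * pi * of_int (int q * k)"
    by (simp add: algebra_simps)
  then show "cos (2 * pi * real q * x) = cos (2 * pi * real q * y)"
    by (simp only: cos_add cos_int_2pin sin_int_2pin)
qed


section \<open>Continued fractions\<close>

text \<open>The Gauss-map orbit of \<open>x mod 1\<close>; \<open>cf_digit x n\<close> is the partial quotient \<open>a\<^sub>n\<close>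
  of \<open>x mod 1 = [0; a\<^sub>1, a\<^sub>2, \<dots>]\<close> for \<open>n \<ge> 1\<close> and \<open>x\<close> irrational.\<close>

primrec gauss_orbit :: "real \<Rightarrow> nat \<Rightarrow> real" where
  "gauss_orbit x 0 = frac x"
| "gauss_orbit x (Suc n) = frac (1 / gauss_orbit x n)"

definition cf_digit :: "real \<Rightarrow> nat \<Rightarrow> nat" where
  "cf_digit x n = nat \<lfloor>1 / gauss_orbit x (n - 1)\<rfloor>"

text \<open>The second equation is the recurrence at index 1, with \<open>q\<^sub>-\<^sub>1 = 0\<close>.\<close>

fun cf_denom_real :: "real \<Rightarrow> nat \<Rightarrow> nat" where
  "cf_denom_real x 0 = 1"
| "cf_denom_real x (Suc 0) = cf_digit x 1"
| "cf_denom_real x (Suc (Suc n)) =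
     cf_digit x (Suc (Suc n)) * cf_denom_real x (Suc n) + cf_denom_real x n"

lemma gauss_orbit_cong:
  assumes "x - y \<in> \<int>"
  shows "gauss_orbit x = gauss_orbit y"
proof
  show "gauss_orbit x n = gauss_orbit y n" for n
  proof (induction n)
    case 0
    from assms obtain k :: int where "x = y + of_int k"
      by (metis Ints_cases add.commute diff_add_cancel)
    then show ?case
      by (simp add: frac_def)
  qed simp
qed

lemma cf_denom_real_cong:
  assumes "x - y \<in> \<int>"
  shows "cf_denom_real x n = cf_denom_real y n"
proof -
  have "cf_digit x = cf_digit y"
    by (rule ext) (simp only: cf_digit_def gauss_orbit_cong[OF assms])
  then show ?thesis
    by (induction n rule: induct_nat_012) simp_all
qed

lift_definition cf_denom :: "circle \<Rightarrow> nat \<Rightarrow> nat" is cf_denom_real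
  by (rule ext) (rule cf_denom_real_cong)

text \<open>\<open>\<alpha>\<close> is used at the indices \<open>1, \<dots>, d\<close> only. The value at \<open>j = d + 1\<close> is the convention
  \<open>q\<^sub>n\<^bsup>(d+1)\<^esup> = q\<^sub>n\<^sub>+\<^sub>1\<^bsup>(1)\<^esup>\<close>.\<close>

definition cf_denom_cyclic :: "nat \<Rightarrow> (nat \<Rightarrow> circle) \<Rightarrow> nat \<Rightarrow> nat \<Rightarrow> nat" where
  "cf_denom_cyclic d \<alpha> j n =
     (if j = d + 1 then cf_denom (\<alpha> 1) (n + 1) else cf_denom (\<alpha> j) n)"

definition class_C :: "nat \<Rightarrow> real \<Rightarrow> (nat \<Rightarrow> circle) set" where
  "class_C d a = {\<alpha>.
     (\<forall>j\<in>{1..d}. irrational_circle (\<alpha> j)) \<and>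
     (\<forall>j\<in>{1..d}. \<forall>n\<ge>1.
        4 * real (cf_denom_cyclic d \<alpha> j n) powr a \<le> real (cf_denom_cyclic d \<alpha> (j + 1) n) \<and>
        real (cf_denom_cyclic d \<alpha> (j + 1) n)
          \<le> real_of_int (2 * \<lceil>4 powr (a + 2)\<rceil>) * real (cf_denom_cyclic d \<alpha> j n) powr a)}"


section \<open>Dynamics\<close>

definition rotation :: "circle ^ 'd \<Rightarrow> circle ^ 'd \<Rightarrow> circle ^ 'd" where
  "rotation \<alpha> x = x + \<alpha>"

definition int_iterate :: "('a \<Rightarrow> 'a) \<Rightarrow> int \<Rightarrow> 'a \<Rightarrow> 'a" where
  "int_iterate T k = (if k \<ge> 0 then T ^^ nat k else inv T ^^ nat (- k))"

text \<open>Meant for homeomorphisms: every full orbit is dense.\<close>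

definition minimal_homeo :: "('a::topological_space \<Rightarrow> 'a) \<Rightarrow> bool" where
  "minimal_homeo T \<longleftrightarrow> (\<forall>x. closure (range (\<lambda>k::int. int_iterate T k x)) = UNIV)"

definition birkhoff_sum :: "('a \<Rightarrow> 'a) \<Rightarrow> ('a \<Rightarrow> real) \<Rightarrow> int \<Rightarrow> 'a \<Rightarrow> real" where
  "birkhoff_sum T \<phi> m x =
     (if m > 0 then \<Sum>k\<in>{0..m - 1}. \<phi> (int_iterate T k x)
      else if m = 0 then 0
      else - (\<Sum>k\<in>{1..\<bar>m\<bar>}. \<phi> (int_iterate T (- k) x)))"


section \<open>Functions of class \<open>C\<^sup>k\<close>\<close>

text \<open>\<open>f\<close> is of class \<open>C\<^sup>k\<^sup>+\<^sup>1\<close> iff it is differentiable and all its directional derivatives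
  are of class \<open>C\<^sup>k\<close>.\<close>

primrec class_Ck :: "nat \<Rightarrow> ('a::euclidean_space \<Rightarrow> real) \<Rightarrow> bool" where
  "class_Ck 0 f \<longleftrightarrow> continuous_on UNIV f"
| "class_Ck (Suc k) f \<longleftrightarrow>
     (\<forall>x. f differentiable (at x)) \<and>
     (\<forall>v. class_Ck k (\<lambda>x. frechet_derivative f (at x) v))"

text \<open>A function on the torus is \<open>C\<^sup>k\<close> iff its periodic lift to \<open>\<real>\<^sup>d\<close> is.\<close>

definition class_Ck_torus :: "nat \<Rightarrow> (circle ^ 'd \<Rightarrow> real) \<Rightarrow> bool" where
  "class_Ck_torus k \<phi> \<longleftrightarrow> class_Ck k (\<lambda>x :: real ^ 'd. \<phi> (\<chi> j. to_circle (x $ j)))"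


section \<open>The functions \<open>\<phi>\<close> and the sets \<open>F\<close>\<close>

definition f_bump :: "real \<Rightarrow> real \<Rightarrow> circle \<Rightarrow> nat \<Rightarrow> circle \<Rightarrow> real" where
  "f_bump abar \<epsilon> \<alpha> n x =
     real (cf_denom \<alpha> (n + 1)) / real (cf_denom \<alpha> n) powr (1 + abar - \<epsilon>)
       * (1 - cos_circle (cf_denom \<alpha> n) x)"

text \<open>The summation index runs over \<open>n + 1 = 1, 2, \<dots>\<close>.\<close>

definition phi_term :: "real \<Rightarrow> real \<Rightarrow> circle \<Rightarrow> circle \<Rightarrow> nat \<Rightarrow> real" where
  "phi_term abar \<epsilon> \<alpha> x n =
     f_bump abar \<epsilon> \<alpha> (n + 1) (x + \<alpha>) - f_bump abar \<epsilon> \<alpha> (n + 1) x"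

definition phi_comp :: "real \<Rightarrow> real \<Rightarrow> circle \<Rightarrow> circle \<Rightarrow> real" where
  "phi_comp abar \<epsilon> \<alpha> x = (\<Sum>n. phi_term abar \<epsilon> \<alpha> x n)"

definition phi :: "real \<Rightarrow> real \<Rightarrow> circle ^ 'd \<Rightarrow> circle ^ 'd \<Rightarrow> real" where
  "phi abar \<epsilon> \<alpha> x = (\<Sum>j\<in>UNIV. phi_comp abar \<epsilon> (\<alpha> $ j) (x $ j))"

definition F_set :: "circle \<Rightarrow> circle set" where
  "F_set \<alpha> = (\<Inter>n\<in>{1..}. \<Union>l\<in>{0..<cf_denom \<alpha> n}.
     let q = real (cf_denom \<alpha> n); q' = real (cf_denom \<alpha> (n + 1)); r = 1 / sqrt (q * q')
     in to_circle ` {real l / q - r .. real l / q + r})"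

end

theory Submission
  imports Defs
begin

text \<open>
  Since \<open>\<parallel>q\<^sub>n \<alpha>\<parallel> \<le> 1 / q\<^sub>n\<^sub>+\<^sub>1\<close>, the \<open>i\<close>-th derivative of the \<open>n\<close>-th term of \<open>\<phi>\<^sub>j\<close> is bounded by a
  constant times \<open>q\<^sub>n\<close> to the power \<open>i - 1 - abar + \<epsilon>\<close>, which is summable for
  \<open>i < 1 + abar - \<epsilon>\<close>; this gives the smoothness.

  The Birkhoff sum over \<open>m\<close> steps telescopes to the sum over \<open>j\<close> and \<open>n\<close> of
  \<open>f\<^sub>n\<^sub>,\<^sub>j (x\<^sub>j + m \<alpha>\<^sub>j) - f\<^sub>n\<^sub>,\<^sub>j (x\<^sub>j)\<close>. On \<open>F\<close> the subtracted part converges, and \<open>f\<^sub>n\<^sub>,\<^sub>j \<ge> 0\<close>, so it is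
  enough that a single \<open>f\<^sub>n\<^sub>,\<^sub>j (x\<^sub>j + m \<alpha>\<^sub>j)\<close> is large. As \<open>\<parallel>q\<^sub>n \<alpha>\<parallel> \<ge> 1 / (2 q\<^sub>n\<^sub>+\<^sub>1)\<close>, this term is at least a
  constant times \<open>q\<^sub>n powr \<epsilon>\<close> as soon as \<open>q\<^sub>n powr a ^ (d - 1) \<le> 4 \<bar>m\<bar> \<le> q\<^sub>n\<^sub>+\<^sub>1\<close> and \<open>n\<close> is large.
  Arranging all denominators in one sequence \<open>Q\<close>, with \<open>Q (k + 1)\<close> comparable to \<open>Q k powr a\<close>, shows
  that these windows cover all large \<open>\<bar>m\<bar>\<close>.
\<close>

section \<open>Convergent denominators\<close>

lemma gauss_orbit_irrational:
  assumes "x \<notin> \<rat>"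
  shows "gauss_orbit x n \<notin> \<rat>"
proof -
  have frac_irr: "frac y \<notin> \<rat>" if "y \<notin> \<rat>" for y :: real
    using that Rats_add[of "frac y" "of_int \<lfloor>y\<rfloor>"] by (auto simp: frac_def)
  show ?thesis
  proof (induction n)
    case (Suc n)
    then have "1 / gauss_orbit x n \<notin> \<rat>"
      using Rats_inverse[of "1 / gauss_orbit x n"] by (auto simp: divide_inverse)
    then show ?case by (simp add: frac_irr)
  qed (simp add: frac_irr assms)
qed

lemma gauss_orbit_bounds:
  assumes "x \<notin> \<rat>"
  shows "0 < gauss_orbit x n" "gauss_orbit x n < 1"
proof -
  have "gauss_orbit x n \<noteq> 0"
    using gauss_orbit_irrational[OF assms, of n] by auto
  moreover have "gauss_orbit x n \<ge> 0" by (cases n) auto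
  ultimately show "0 < gauss_orbit x n" by simp
  show "gauss_orbit x n < 1" by (cases n) (auto simp: frac_lt_1)
qed

lemma cf_digit_Suc:
  assumes "x \<notin> \<rat>"
  shows "real (cf_digit x (Suc n)) = 1 / gauss_orbit x n - gauss_orbit x (Suc n)"
    and "cf_digit x (Suc n) \<ge> 1"
proof -
  have "1 / gauss_orbit x n > 1"
    using gauss_orbit_bounds[OF assms, of n] by (simp add: field_simps)
  then have ge: "\<lfloor>1 / gauss_orbit x n\<rfloor> \<ge> 1" by linarith
  then have "real (cf_digit x (Suc n)) = of_int \<lfloor>1 / gauss_orbit x n\<rfloor>"
    unfolding cf_digit_def diff_Suc_1 by (intro of_nat_nat) linarith
  then show "real (cf_digit x (Suc n)) = 1 / gauss_orbit x n - gauss_orbit x (Suc n)"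
    by (simp add: frac_def)
  show "cf_digit x (Suc n) \<ge> 1"
    unfolding cf_digit_def diff_Suc_1 using ge by linarith
qed

lemma cf_denom_real_pos:
  assumes "x \<notin> \<rat>"
  shows "cf_denom_real x n \<ge> 1"
  using cf_digit_Suc(2)[OF assms] by (induction n rule: induct_nat_012) (auto simp: Suc_le_eq)

lemma cf_denom_real_mono:
  assumes "x \<notin> \<rat>"
  shows "cf_denom_real x n \<le> cf_denom_real x (Suc n)"
proof (cases n)
  case 0
  then show ?thesis using cf_digit_Suc(2)[OF assms, of 0] by simp
next
  case (Suc m)
  then show ?thesis
    using cf_digit_Suc(2)[OF assms, of n] by (simp add: Suc_le_eq trans_le_add1)
qed

text \<open>This product is \<open>|q_n x - p_n|\<close> for the convergents
  \<open>p_n / q_n\<close> of \<open>x\<close>; in product form it is visibly positive and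
  decreasing.\<close>

definition cf_dist :: "real \<Rightarrow> nat \<Rightarrow> real" where
  "cf_dist x n = (\<Prod>i\<le>n. gauss_orbit x i)"

lemma cf_dist_pos:
  assumes "x \<notin> \<rat>"
  shows "cf_dist x n > 0"
  unfolding cf_dist_def using gauss_orbit_bounds[OF assms] by (intro prod_pos) auto

lemma cf_dist_Suc_le:
  assumes "x \<notin> \<rat>"
  shows "cf_dist x (Suc n) \<le> cf_dist x n"
  using cf_dist_pos[OF assms, of n] gauss_orbit_bounds[OF assms, of "Suc n"]
  by (simp add: cf_dist_def mult_left_le del: gauss_orbit.simps)

lemma cf_dist_1:
  assumes "x \<notin> \<rat>"
  shows "cf_dist x (Suc 0) = 1 - real (cf_digit x (Suc 0)) * cf_dist x 0"
  using gauss_orbit_bounds[OF assms, of 0]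
  by (simp add: cf_dist_def cf_digit_Suc[OF assms] field_simps del: gauss_orbit.simps)

text \<open>Multiply \<open>cf_digit_Suc\<close> by \<open>cf_dist x (Suc n)\<close>: dividing out
  the last factor recovers \<open>cf_dist x n\<close>. With the sign \<open>(-1) ^ n\<close>
  attached, this is the recurrence of the denominators.\<close>

lemma cf_dist_rec:
  assumes "x \<notin> \<rat>"
  shows "cf_dist x (Suc (Suc n)) = cf_dist x n - real (cf_digit x (Suc (Suc n))) * cf_dist x (Suc n)"
  using gauss_orbit_bounds[OF assms, of "Suc n"]
  by (simp add: cf_dist_def cf_digit_Suc[OF assms] field_simps del: gauss_orbit.simps)

text \<open>The two recurrences have opposite signs, so this bilinear expression does not change
  with \<open>n\<close>; at \<open>n = 0\<close> it reduces to \<open>cf_dist_1\<close>.\<close>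

lemma cf_denom_cf_dist:
  assumes "x \<notin> \<rat>"
  shows "cf_denom_real x (Suc n) * cf_dist x n + cf_denom_real x n * cf_dist x (Suc n) = 1"
  by (induction n)
    (simp_all add: cf_dist_1[OF assms] cf_dist_rec[OF assms] algebra_simps)

text \<open>Both terms obey one recurrence with integer coefficients, so their difference, the
  numerator of the convergent, stays an integer.\<close>

lemma cf_denom_mult_cong:
  assumes "x \<notin> \<rat>"
  shows "real (cf_denom_real x n) * x - (-1) ^ n * cf_dist x n \<in> \<int>"
proof (induction n rule: induct_nat_012)
  case 0
  then show ?case by (simp add: cf_dist_def frac_def)
next
  case 1
  have "real (cf_digit x (Suc 0)) * x + cf_dist x (Suc 0) =
     real (cf_digit x (Suc 0)) * of_int \<lfloor>x\<rfloor> + 1"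
    by (simp add: cf_dist_1[OF assms]) (simp add: cf_dist_def frac_def algebra_simps)
  then show ?case by simp
next
  case (ge2 n)
  have "real (cf_denom_real x (Suc (Suc n))) * x - (-1) ^ Suc (Suc n) * cf_dist x (Suc (Suc n)) =
      real (cf_digit x (Suc (Suc n))) *
        (real (cf_denom_real x (Suc n)) * x - (-1) ^ Suc n * cf_dist x (Suc n))
      + (real (cf_denom_real x n) * x - (-1) ^ n * cf_dist x n)"
    by (simp add: cf_dist_rec[OF assms] algebra_simps)
  then show ?case using ge2 by simp
qed

text \<open>Take \<delta> to be \<open>(-1) ^ n * cf_dist x n\<close>. In
  \<open>cf_denom_cf_dist\<close> both summands are non-negative, which gives the upper bound, and
  the first is the larger, which gives the lower bound.\<close>

lemma cf_denom_approx:
  assumes "x \<notin> \<rat>"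
  obtains \<delta> :: real where "real (cf_denom_real x n) * x - \<delta> \<in> \<int>"
    "\<bar>\<delta>\<bar> * real (cf_denom_real x (Suc n)) \<le> 1"
    "1 \<le> 2 * real (cf_denom_real x (Suc n)) * \<bar>\<delta>\<bar>"
proof
  let ?q = "cf_denom_real x" and ?D = "cf_dist x"
  note pos = cf_dist_pos[OF assms]
  show "real (?q n) * x - (-1) ^ n * ?D n \<in> \<int>"
    by (rule cf_denom_mult_cong[OF assms])
  have eq: "?q (Suc n) * ?D n + ?q n * ?D (Suc n) = 1"
    by (rule cf_denom_cf_dist[OF assms])
  have abs: "\<bar>(-1) ^ n * ?D n\<bar> = ?D n"
    using pos[of n] by (simp add: abs_mult power_abs)
  have "?q n * ?D (Suc n) \<ge> 0"
    using pos[of "Suc n"] by simp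
  then show "\<bar>(-1) ^ n * ?D n\<bar> * real (?q (Suc n)) \<le> 1"
    using eq unfolding abs by (simp add: mult.commute)
  have "?q n * ?D (Suc n) \<le> ?q (Suc n) * ?D n"
    using pos[of "Suc n"] cf_dist_Suc_le[OF assms, of n] cf_denom_real_mono[OF assms, of n]
    by (intro mult_mono) auto
  then show "1 \<le> 2 * real (?q (Suc n)) * \<bar>(-1) ^ n * ?D n\<bar>"
    using eq unfolding abs by linarith
qed

section \<open>Smoothness\<close>

text \<open>The weights \<open>w\<close> close the induction: the derivative in direction
  \<open>v\<close> has the same shape, with weights \<open>w j * v $ j\<close> and the chain
  \<open>H\<close> shifted by one.\<close>

lemma class_Ck_sum_components:
  fixes H :: "'d::finite \<Rightarrow> nat \<Rightarrow> real \<Rightarrow> real" and w :: "'d \<Rightarrow> real"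
  assumes "\<And>j i t. i < k \<Longrightarrow> (H j i has_real_derivative H j (Suc i) t) (at t)"
    and "\<And>j. continuous_on UNIV (H j k)"
  shows "class_Ck k (\<lambda>x::real^'d. \<Sum>j\<in>UNIV. w j * H j 0 (x $ j))"
  using assms
proof (induction k arbitrary: H w)
  case 0
  have "continuous_on UNIV (\<lambda>x::real^'d. H j 0 (x $ j))" for j
    by (rule continuous_on_compose2[OF 0(2)]) (auto intro!: continuous_intros)
  then show ?case by (auto intro!: continuous_intros)
next
  case (Suc k)
  let ?f = "\<lambda>x::real^'d. \<Sum>j\<in>UNIV. w j * H j 0 (x $ j)"
  let ?f' = "\<lambda>(x::real^'d) v. \<Sum>j\<in>UNIV. (w j * v $ j) * H j (Suc 0) (x $ j)"
  have "((\<lambda>x. H j 0 (x $ j)) has_derivative (\<lambda>v. H j (Suc 0) (x $ j) * v $ j)) (at x)"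
    for j and x :: "real^'d"
    using has_derivative_compose[OF bounded_linear_imp_has_derivative[OF bounded_linear_vec_nth]
        Suc.prems(1)[of 0 j "x $ j", unfolded has_field_derivative_def]]
    by simp
  then have deriv: "(?f has_derivative ?f' x) (at x)" for x
    by (auto intro!: derivative_eq_intros simp: algebra_simps)
  have "class_Ck k (\<lambda>x. ?f' x v)" for v
    using Suc.IH[of "\<lambda>j i. H j (Suc i)" "\<lambda>j. w j * v $ j"] Suc.prems by auto
  moreover have "frechet_derivative ?f (at x) = ?f' x" for x
    using frechet_derivative_at[OF deriv] by simp
  ultimately show ?case
    using deriv by (auto simp: differentiable_def)
qed

section \<open>Termwise differentiation of the series for \<open>phi_comp\<close>\<close>

lemma to_circle_add: "to_circle s + to_circle t = to_circle (s + t)"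
  by (rule plus_circle.abs_eq)

lemma f_bump_to_circle:
  "f_bump b \<epsilon> \<alpha> n (to_circle t) = real (cf_denom \<alpha> (Suc n)) / real (cf_denom \<alpha> n) powr (1 + b - \<epsilon>)
     * (1 - cos (2 * pi * real (cf_denom \<alpha> n) * t))"
  by (simp add: f_bump_def cos_circle.abs_eq)

lemma abs_cos_diff_le: "\<bar>cos u - cos v\<bar> \<le> \<bar>u - v\<bar>" for u v :: real
proof -
  have "\<bar>cos u - cos v\<bar> = 2 * \<bar>sin ((u + v) / 2)\<bar> * \<bar>sin ((v - u) / 2)\<bar>"
    by (simp add: cos_diff_cos abs_mult)
  also have "\<dots> \<le> 2 * 1 * \<bar>(v - u) / 2\<bar>"
    by (intro mult_mono abs_sin_x_le_abs_x) auto
  finally show ?thesis by simp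
qed

text \<open>Modulo 1 the shift by \<open>A\<close> moves \<open>q * t\<close> only by \<delta>. The
  phase \<open>c\<close> lets the bound serve the derivatives of cosine as well.\<close>

lemma cos_shift_diff_le:
  fixes \<delta> A t c :: real
  assumes "real q * A - \<delta> \<in> \<int>" "\<bar>\<delta>\<bar> * q' \<le> 1" "q' > 0"
  shows "\<bar>cos (2 * pi * real q * t + c) - cos (2 * pi * real q * (t + A) + c)\<bar> \<le> 2 * pi / q'"
proof -
  obtain k where k: "real q * A = \<delta> + of_int k"
    using assms(1) by (metis Ints_cases add.commute diff_add_cancel)
  have "2 * pi * real q * (t + A) + c = (2 * pi * real q * t + c + 2 * pi * \<delta>) + 2 * pi * of_int k"
    using k by (simp add: algebra_simps) (simp add: mult.left_commute flip: distrib_left)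
  then have "cos (2 * pi * real q * (t + A) + c) = cos (2 * pi * real q * t + c + 2 * pi * \<delta>)"
    by (simp only: cos_add[of _ "2 * pi * of_int k"] cos_int_2pin sin_int_2pin)
  then have "\<bar>cos (2 * pi * real q * t + c) - cos (2 * pi * real q * (t + A) + c)\<bar> \<le> 2 * pi * \<bar>\<delta>\<bar>"
    using abs_cos_diff_le[of "2 * pi * real q * t + c" "2 * pi * real q * t + c + 2 * pi * \<delta>"]
    by (simp add: abs_mult)
  also have "\<dots> \<le> 2 * pi * (1 / q')"
    using assms by (intro mult_left_mono) (auto simp: field_simps)
  finally show ?thesis by simp
qed

lemma summable_powr_geometric:
  fixes q :: "nat \<Rightarrow> real"
  assumes "\<And>n. 4 ^ n \<le> q n" "s < 0"
  shows "summable (\<lambda>n. q n powr s)"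
proof (rule summable_comparison_test')
  show "summable (\<lambda>n. (4 powr s) ^ n)"
    using assms(2) by (intro summable_geometric) (simp add: powr_less_one)
  show "norm (q n powr s) \<le> (4 powr s) ^ n" for n
    using powr_mono2'[of s "4 ^ n" "q n"] assms
    by (simp add: powr_powr powr_realpow[symmetric] mult.commute)
qed

text \<open>The factor \<open>2 * pi / q'\<close> gained from the shift cancels the numerator of
  \<open>c n\<close>, so the derivative of order \<open>i\<close> is majorised by a multiple of
  \<open>q n powr (i - s)\<close>. This is summable for \<open>i \<le> k < s\<close>, and the M-test
  applies up to order \<open>k\<close>.\<close>

lemma phi_comp_derivatives:
  fixes A b \<epsilon> :: real
  assumes A: "A \<notin> \<rat>" and growth: "\<And>n. 4 ^ n \<le> real (cf_denom (to_circle A) (Suc n))"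
    and k: "real k < 1 + b - \<epsilon>"
  obtains H where "H 0 = (\<lambda>t. phi_comp b \<epsilon> (to_circle A) (to_circle t))"
    "\<And>i t. i < k \<Longrightarrow> (H i has_real_derivative H (Suc i) t) (at t)"
    "continuous_on UNIV (H k)"
    "\<And>t. summable (phi_term b \<epsilon> (to_circle A) (to_circle t))"
proof -
  define q where "q n = cf_denom (to_circle A) (Suc n)" for n
  define s where "s = 1 + b - \<epsilon>"
  define c where "c n = real (q (Suc n)) / real (q n) powr s" for n
  \<comment> \<open>\<open>E i n\<close> is the \<open>i\<close>-th derivative of the \<open>n\<close>-th term, as \<open>\<lambda>y. cos (y + i \<pi>/2)\<close> is that of \<open>cos\<close>.\<close>
  define E where "E i n t = c n * (2 * pi * real (q n)) ^ i *
      (cos (2 * pi * real (q n) * t + real i * (pi / 2))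
        - cos (2 * pi * real (q n) * (t + A) + real i * (pi / 2)))"
    for i n t
  define H where "H i t = (\<Sum>n. E i n t)" for i t
  define M where "M i n = (2 * pi) ^ Suc i * real (q n) powr (real i - s)" for i n
  have growth': "4 ^ n \<le> real (q n)" for n
    using growth by (simp add: q_def)
  have q_pos: "q n > 0" for n
    using growth'[of n] by (metis of_nat_0_less_iff less_le_trans zero_less_numeral zero_less_power)
  have E_bound: "norm (E i n t) \<le> M i n" for i n t
  proof -
    obtain \<delta> where \<delta>: "real (q n) * A - \<delta> \<in> \<int>" "\<bar>\<delta>\<bar> * real (q (Suc n)) \<le> 1"
      using cf_denom_approx[OF A, of "Suc n"] by (metis q_def cf_denom.abs_eq)
    have "norm (E i n t) = c n * (2 * pi * real (q n)) ^ i *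
      \<bar>cos (2 * pi * real (q n) * t + real i * (pi / 2))
        - cos (2 * pi * real (q n) * (t + A) + real i * (pi / 2))\<bar>"
      by (simp add: E_def abs_mult c_def)
    also have "\<dots> \<le> c n * (2 * pi * real (q n)) ^ i * (2 * pi / real (q (Suc n)))"
      by (intro mult_left_mono cos_shift_diff_le[OF \<delta>]) (auto simp: c_def q_pos)
    also have "\<dots> = M i n"
      using q_pos[of n] q_pos[of "Suc n"]
      by (simp add: c_def M_def powr_diff powr_realpow power_mult_distrib field_simps)
    finally show ?thesis .
  qed
  have M_summable: "summable (M i)" if "i \<le> k" for i
    unfolding M_def using that k
    by (intro summable_mult summable_powr_geometric growth') (auto simp: s_def)
  have E_summable: "summable (\<lambda>n. E i n t)" if "i \<le> k" for i t
    by (rule summable_comparison_test'[OF M_summable[OF that], of 0]) (rule E_bound)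
  have E_deriv: "(E i n has_real_derivative E (Suc i) n t) (at t)" for i n t
  proof -
    have *: "cos (y + real (Suc i) * (pi / 2)) = - sin (y + real i * (pi / 2))" for y
      using minus_sin_cos_eq[of "y + real i * (pi / 2)"]
      by (simp add: algebra_simps add_divide_distrib)
    show ?thesis
      unfolding E_def * by (auto intro!: derivative_eq_intros simp: algebra_simps)
  qed
  have E_0: "E 0 n t = phi_term b \<epsilon> (to_circle A) (to_circle t) n" for n t
    by (simp add: E_def phi_term_def to_circle_add f_bump_to_circle c_def s_def q_def
        right_diff_distrib diff_divide_distrib)
  show ?thesis
  proof
    show "H 0 = (\<lambda>t. phi_comp b \<epsilon> (to_circle A) (to_circle t))"
      by (simp add: H_def E_0 phi_comp_def fun_eq_iff)
    show "(H i has_real_derivative H (Suc i) t) (at t)" if "i < k" for i t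
      unfolding H_def
    proof (rule has_field_derivative_series'(2)[of UNIV])
      show "uniformly_convergent_on UNIV (\<lambda>n x. \<Sum>m<n. E (Suc i) m x)"
        using that by (intro Weierstrass_m_test'[OF E_bound] M_summable) auto
    qed (use that E_deriv E_summable in auto)
    show "continuous_on UNIV (H k)"
      unfolding H_def
    proof (rule uniform_limit_theorem)
      show "uniform_limit UNIV (\<lambda>n t. \<Sum>m<n. E k m t) (\<lambda>t. \<Sum>m. E k m t) sequentially"
        by (intro Weierstrass_m_test[OF E_bound] M_summable) auto
      show "\<forall>\<^sub>F n in sequentially. continuous_on UNIV (\<lambda>t. \<Sum>m<n. E k m t)"
        unfolding E_def by (intro always_eventually allI continuous_intros)
    qed auto
    show "summable (phi_term b \<epsilon> (to_circle A) (to_circle t))" for t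
      using E_summable[of 0 t] by (simp add: E_0)
  qed
qed

section \<open>Birkhoff sums over rotations\<close>

lemma to_circle_diff: "to_circle s - to_circle t = to_circle (s - t)"
  by (rule minus_circle.abs_eq)

lemma to_circle_surj: obtains t where "x = to_circle t"
  using Quotient_abs_rep[OF Quotient_circle, of x] by metis

lemma inv_rotation: "inv (rotation \<alpha>) = (\<lambda>x. x - \<alpha>)"
  by (rule inv_unique_comp) (auto simp: rotation_def fun_eq_iff)

lemma int_iterate_rotation:
  "int_iterate (rotation (\<chi> j. to_circle (A j))) k (\<chi> j. to_circle (X j)) =
     (\<chi> j. to_circle (X j + of_int k * A j))"
proof -
  let ?R = "rotation (\<chi> j. to_circle (A j))"
  have pos: "(?R ^^ n) (\<chi> j. to_circle (X j)) = (\<chi> j. to_circle (X j + real n * A j))" for n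
    by (induction n) (simp_all add: rotation_def vec_eq_iff to_circle_add algebra_simps)
  have neg: "(inv ?R ^^ n) (\<chi> j. to_circle (X j)) = (\<chi> j. to_circle (X j - real n * A j))" for n
    by (induction n) (simp_all add: inv_rotation vec_eq_iff to_circle_diff algebra_simps)
  show ?thesis
    by (cases "k \<ge> 0") (auto simp: int_iterate_def pos neg)
qed

text \<open>The transfer function \<open>G\<close> depends on the time along one orbit rather than
  on the point, since the series of bumps is summed only along orbits starting in
  \<open>F_set\<close>.\<close>

lemma birkhoff_sum_coboundary:
  assumes "\<And>k. \<phi> (int_iterate T k x) = G (k + 1) - G k"
  shows "birkhoff_sum T \<phi> m x = G m - G 0"
proof -
  have pos: "(\<Sum>k\<in>{0..int n - 1}. G (k + 1) - G k) = G (int n) - G 0" for n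
  proof (induction n)
    case (Suc n)
    have "{0..int (Suc n) - 1} = insert (int n) {0..int n - 1}" by auto
    then show ?case using Suc by (simp add: add.commute)
  qed simp
  have neg: "(\<Sum>k\<in>{1..int n}. G (- k + 1) - G (- k)) = G 0 - G (- int n)" for n
  proof (induction n)
    case (Suc n)
    have "{1..int (Suc n)} = insert (int n + 1) {1..int n}" by auto
    then show ?case using Suc by (simp add: add.commute)
  qed simp
  show ?thesis
    using pos[of "nat m"] neg[of "nat (- m)"] by (auto simp: birkhoff_sum_def assms)
qed

section \<open>Bounds for single bumps along orbits starting in \<open>F_set\<close>\<close>

lemma f_bump_nonneg: "f_bump b \<epsilon> \<alpha> n x \<ge> 0"
  by (induction x rule: circle.abs_induct) (simp add: f_bump_to_circle)

lemma cos_shift_int: "cos (2 * pi * (t + of_int k)) = cos (2 * pi * t)"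
  by (simp only: distrib_left cos_add cos_int_2pin sin_int_2pin)

lemma one_minus_cos: "1 - cos (2 * pi * t) = 2 * (sin (pi * t))\<^sup>2" for t :: real
  using cos_double_sin[of "pi * t"] by (simp add: mult.assoc)

lemma one_minus_cos_le: "1 - cos (2 * pi * t) \<le> 2 * pi\<^sup>2 * t\<^sup>2" for t :: real
proof -
  have "(sin (pi * t))\<^sup>2 \<le> (pi * t)\<^sup>2"
    using abs_sin_x_le_abs_x[of "pi * t"] by (simp add: abs_le_square_iff)
  then show ?thesis unfolding one_minus_cos by (simp add: power_mult_distrib)
qed

text \<open>As \<open>pi < 16/5\<close>, the argument \<open>y = pi * \<bar>t\<bar>\<close> is at
  most 1, where Taylor gives \<open>sin y \<ge> y / 2 \<ge> \<bar>t\<bar>\<close>. The range 5/16 =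
  1/16 + 1/4 is the one met in \<open>f_bump_ge_on_F_set\<close>.\<close>

lemma one_minus_cos_ge:
  fixes t :: real
  assumes "\<bar>t\<bar> \<le> 5/16"
  shows "1 - cos (2 * pi * t) \<ge> 2 * t\<^sup>2"
proof -
  define y where "y = pi * \<bar>t\<bar>"
  have "pi * \<bar>t\<bar> \<le> 16/5 * (5/16)"
    using assms pi_approx by (intro mult_mono) auto
  then have y: "0 \<le> y" "y \<le> 1"
    by (auto simp: y_def)
  have "{..<2::nat} = {0, 1}" by auto
  then have "\<bar>sin y - y\<bar> \<le> \<bar>y\<bar>\<^sup>2 / 2"
    using Maclaurin_sin_bound[of y 2] by (simp add: sin_coeff_def)
  moreover have "\<bar>y\<bar>\<^sup>2 \<le> y"
    using mult_mono[of y 1 y y] y by (simp add: power2_eq_square)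
  ultimately have "sin y \<ge> y / 2" by linarith
  moreover have "y / 2 \<ge> \<bar>t\<bar>"
    unfolding y_def using mult_right_mono[of 2 pi "\<bar>t\<bar>"] pi_ge_two by simp
  ultimately have "\<bar>t\<bar> \<le> sin y" by simp
  then have "\<bar>t\<bar>\<^sup>2 \<le> (sin y)\<^sup>2" by (rule power_mono) simp
  also have "(sin y)\<^sup>2 = (sin (pi * t))\<^sup>2" by (cases "t \<ge> 0") (simp_all add: y_def)
  finally show ?thesis unfolding one_minus_cos by simp
qed

text \<open>\<eta> is \<open>q\<close> times the displacement of the point from a nearby
  \<open>l / q\<close>, so \<open>\<bar>\<eta>\<bar> \<le> q * r = sqrt (q / q')\<close>; squaring
  removes the root.\<close>

lemma F_set_approx:
  assumes "to_circle X \<in> F_set \<alpha>" "cf_denom \<alpha> (Suc n) > 0" "cf_denom \<alpha> (Suc (Suc n)) > 0"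
  obtains \<eta> where "real (cf_denom \<alpha> (Suc n)) * X - \<eta> \<in> \<int>"
    "\<eta>\<^sup>2 * real (cf_denom \<alpha> (Suc (Suc n))) \<le> real (cf_denom \<alpha> (Suc n))"
proof -
  define q q' where "q = real (cf_denom \<alpha> (Suc n))" and "q' = real (cf_denom \<alpha> (Suc (Suc n)))"
  have q: "q > 0" "q' > 0" using assms by (auto simp: q_def q'_def)
  define r where "r = 1 / sqrt (q * q')"
  obtain l y where ly: "y \<in> {real l / q - r .. real l / q + r}" "to_circle X = to_circle y"
    using assms(1) unfolding F_set_def Let_def q_def q'_def r_def by fastforce
  have "X - y \<in> \<int>"
    using ly(2) circle.abs_eq_iff by blast
  then obtain p where p: "X = y + of_int p"
    by (metis Ints_cases add.commute diff_add_cancel)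
  have "q * X - q * (y - real l / q) = real (cf_denom \<alpha> (Suc n)) * of_int p + real l"
    using p q by (simp add: field_simps q_def)
  then have int: "q * X - q * (y - real l / q) \<in> \<int>" by simp
  have "\<bar>y - real l / q\<bar> \<le> r" using ly(1) by auto
  then have "(y - real l / q)\<^sup>2 \<le> r\<^sup>2" by (rule abs_le_square_iff[THEN iffD1, OF order_trans]) simp
  then have "q\<^sup>2 * (y - real l / q)\<^sup>2 * q' \<le> q\<^sup>2 * r\<^sup>2 * q'"
    using q by (intro mult_left_mono mult_right_mono) auto
  also have "\<dots> = q"
    using q by (simp add: r_def power_divide power2_eq_square)
  finally show ?thesis
    using that[of "q * (y - real l / q)"] int by (simp add: q_def q'_def power_mult_distrib)
qed

text \<open>Here \<open>1 - cos\<close> is at most \<open>2 * pi\<^sup>2 * q / q'\<close>, and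
  \<open>q'\<close> cancels against the height of the bump. Since \<epsilon> will be less than
  \<open>b\<close>, the result is summable over \<open>n\<close>.\<close>

lemma f_bump_le_on_F_set:
  assumes "to_circle X \<in> F_set \<alpha>" "cf_denom \<alpha> (Suc n) > 0" "cf_denom \<alpha> (Suc (Suc n)) > 0"
  shows "f_bump b \<epsilon> \<alpha> (Suc n) (to_circle X) \<le> 2 * pi\<^sup>2 * real (cf_denom \<alpha> (Suc n)) powr (\<epsilon> - b)"
proof -
  define q q' where "q = real (cf_denom \<alpha> (Suc n))" and "q' = real (cf_denom \<alpha> (Suc (Suc n)))"
  have q: "q > 0" "q' > 0" using assms by (auto simp: q_def q'_def)
  obtain \<eta> where \<eta>: "q * X - \<eta> \<in> \<int>" "\<eta>\<^sup>2 * q' \<le> q"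
    using F_set_approx[OF assms] unfolding q_def q'_def .
  then obtain p where "q * X = \<eta> + of_int p"
    by (metis Ints_cases add.commute diff_add_cancel)
  then have "1 - cos (2 * pi * q * X) \<le> 2 * pi\<^sup>2 * \<eta>\<^sup>2"
    using cos_shift_int[of \<eta> p] one_minus_cos_le[of \<eta>] by (simp add: mult.assoc)
  then have "f_bump b \<epsilon> \<alpha> (Suc n) (to_circle X) \<le> q' / q powr (1 + b - \<epsilon>) * (2 * pi\<^sup>2 * \<eta>\<^sup>2)"
    unfolding f_bump_to_circle q_def[symmetric] q'_def[symmetric]
    using q by (intro mult_left_mono) auto
  also have "\<dots> = 2 * pi\<^sup>2 * (\<eta>\<^sup>2 * q') / q powr (1 + b - \<epsilon>)" by simp
  also have "\<dots> \<le> 2 * pi\<^sup>2 * q / q powr (1 + b - \<epsilon>)"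
    using \<eta>(2) q by (intro divide_right_mono mult_left_mono) auto
  also have "\<dots> = 2 * pi\<^sup>2 * q powr (\<epsilon> - b)"
  proof -
    have "q powr (\<epsilon> - b) * q powr (1 + b - \<epsilon>) = q"
      using q by (simp flip: powr_add)
    then show ?thesis using q by (simp add: field_simps)
  qed
  finally show ?thesis by (simp add: q_def)
qed

text \<open>Modulo 1 the phase is \<open>t = \<eta> + m * \<delta>\<close>. The first bound on
  \<open>m\<close> gives \<open>\<bar>\<eta>\<bar> \<le> \<bar>m\<bar> / (4 * q')\<close>, at most
  half of \<open>\<bar>m * \<delta>\<bar>\<close>, so
  \<open>\<bar>t\<bar> \<ge> \<bar>m\<bar> / (4 * q')\<close>. The second keeps
  \<open>\<bar>\<eta>\<bar> \<le> 1/16\<close> and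
  \<open>\<bar>m * \<delta>\<bar> \<le> 1/4\<close>, within reach of
  \<open>one_minus_cos_ge\<close>.\<close>

lemma f_bump_ge_on_F_set:
  fixes m :: int
  assumes A: "A \<notin> \<rat>" and X: "to_circle X \<in> F_set (to_circle A)"
    and m: "16 * real (cf_denom (to_circle A) (Suc n)) * real (cf_denom (to_circle A) (Suc (Suc n)))
      \<le> (real_of_int m)\<^sup>2"
      "4 * \<bar>real_of_int m\<bar> \<le> real (cf_denom (to_circle A) (Suc (Suc n)))"
  shows "(real_of_int m)\<^sup>2 / (8 * real (cf_denom (to_circle A) (Suc (Suc n)))
      * real (cf_denom (to_circle A) (Suc n)) powr (1 + b - \<epsilon>))
    \<le> f_bump b \<epsilon> (to_circle A) (Suc n) (to_circle (X + of_int m * A))"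
proof -
  define q q' where "q = real (cf_denom (to_circle A) (Suc n))"
    and "q' = real (cf_denom (to_circle A) (Suc (Suc n)))"
  have denom_pos: "cf_denom (to_circle A) i > 0" for i
    using cf_denom_real_pos[OF A, of i] by (simp add: cf_denom.abs_eq)
  have q: "q > 0" "q' > 0" using denom_pos by (auto simp: q_def q'_def)
  define M where "M = \<bar>real_of_int m\<bar>"
  have M: "M \<ge> 0" "16 * q * q' \<le> M\<^sup>2" "4 * M \<le> q'"
    using m by (auto simp: M_def q_def q'_def)
  obtain \<eta> where \<eta>: "q * X - \<eta> \<in> \<int>" "\<eta>\<^sup>2 * q' \<le> q"
    using F_set_approx[OF X denom_pos denom_pos] unfolding q_def q'_def .
  obtain \<delta> where \<delta>: "q * A - \<delta> \<in> \<int>" "\<bar>\<delta>\<bar> * q' \<le> 1" "1 \<le> 2 * q' * \<bar>\<delta>\<bar>"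
    using cf_denom_approx[OF A, of "Suc n"] unfolding q_def q'_def by (metis cf_denom.abs_eq)
  define t where "t = \<eta> + of_int m * \<delta>"
  have "(4 * q' * \<eta>)\<^sup>2 = 16 * q' * (\<eta>\<^sup>2 * q')" by (simp add: power2_eq_square)
  also have "\<dots> \<le> 16 * q' * q" using \<eta>(2) q by (intro mult_left_mono) auto
  also have "\<dots> \<le> M\<^sup>2" using M(2) by (simp add: mult_ac)
  finally have "\<bar>4 * q' * \<eta>\<bar> \<le> M"
    using M(1) by (metis abs_le_square_iff abs_of_nonneg)
  then have \<eta>_le: "4 * q' * \<bar>\<eta>\<bar> \<le> M" using q by (simp add: abs_mult)
  have "M * (\<bar>\<delta>\<bar> * q') \<le> M * 1" "M * 1 \<le> M * (2 * q' * \<bar>\<delta>\<bar>)"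
    using \<delta> M(1) by (intro mult_left_mono; simp)+
  then have m\<delta>: "q' * \<bar>of_int m * \<delta>\<bar> \<le> M" "M \<le> 2 * (q' * \<bar>of_int m * \<delta>\<bar>)"
    by (simp_all add: abs_mult M_def mult_ac)
  have "q' * \<bar>t\<bar> \<le> q' * \<bar>\<eta>\<bar> + q' * \<bar>of_int m * \<delta>\<bar>"
    unfolding t_def distrib_left[symmetric] using q by (intro mult_left_mono abs_triangle_ineq) auto
  also have "\<dots> \<le> q' * (5/16)"
    using \<eta>_le m\<delta> M(3) by simp
  finally have t_le: "\<bar>t\<bar> \<le> 5/16" using q by (simp only: mult_le_cancel_left_pos)
  have "q' * \<bar>of_int m * \<delta>\<bar> \<le> q' * (\<bar>t\<bar> + \<bar>\<eta>\<bar>)"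
    unfolding t_def using q by (intro mult_left_mono) auto
  then have "M \<le> 4 * q' * \<bar>t\<bar>"
    using \<eta>_le m\<delta> by (simp add: distrib_left)
  then have "M\<^sup>2 \<le> (4 * q' * \<bar>t\<bar>)\<^sup>2" using M(1) by (intro power_mono) auto
  then have t_ge: "M\<^sup>2 / (8 * q'\<^sup>2) \<le> 2 * t\<^sup>2"
    using q by (simp add: power_mult_distrib field_simps)
  obtain p1 p2 where p: "q * X = \<eta> + of_int p1" "q * A = \<delta> + of_int p2"
    using \<eta>(1) \<delta>(1) by (metis Ints_cases add.commute diff_add_cancel)
  have "q * (X + of_int m * A) = q * X + of_int m * (q * A)"
    by (simp add: algebra_simps)
  also have "\<dots> = t + of_int (p1 + m * p2)"
    unfolding p t_def by (simp add: algebra_simps)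
  finally have "cos (2 * pi * q * (X + of_int m * A)) = cos (2 * pi * t)"
    using cos_shift_int[of t "p1 + m * p2"] by (simp add: mult.assoc)
  then have "M\<^sup>2 / (8 * q'\<^sup>2) \<le> 1 - cos (2 * pi * q * (X + of_int m * A))"
    using one_minus_cos_ge[OF t_le] t_ge by simp
  then have "q' / q powr (1 + b - \<epsilon>) * (M\<^sup>2 / (8 * q'\<^sup>2))
      \<le> f_bump b \<epsilon> (to_circle A) (Suc n) (to_circle (X + of_int m * A))"
    unfolding f_bump_to_circle q_def[symmetric] q'_def[symmetric]
    using q by (intro mult_left_mono) auto
  also have "q' / q powr (1 + b - \<epsilon>) * (M\<^sup>2 / (8 * q'\<^sup>2)) = M\<^sup>2 / (8 * q' * q powr (1 + b - \<epsilon>))"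
    using q by (simp add: power2_eq_square)
  finally show ?thesis by (simp add: M_def q_def q'_def)
qed

section \<open>Sequences growing like iterated powers\<close>

lemma powr_growth_lower:
  fixes Q :: "nat \<Rightarrow> real"
  assumes "a > 0" "\<And>k. Q k \<ge> 1" "\<And>k. Q k powr a \<le> Q (Suc k)"
  shows "Q k powr (a ^ r) \<le> Q (k + r)"
proof (induction r)
  case 0
  then show ?case using assms(2)[of k] by simp
next
  case (Suc r)
  have "Q k powr (a ^ Suc r) = (Q k powr (a ^ r)) powr a"
    by (simp add: powr_powr mult.commute)
  also have "\<dots> \<le> Q (k + r) powr a"
    using Suc assms(1) by (intro powr_mono2) auto
  also have "\<dots> \<le> Q (k + Suc r)" using assms(3)[of "k + r"] by simp
  finally show ?case .
qed

lemma powr_growth_upper: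
  fixes Q :: "nat \<Rightarrow> real"
  assumes "a > 0" "C > 0" "\<And>k. Q k \<ge> 1" "\<And>k. Q (Suc k) \<le> C * Q k powr a"
  shows "\<exists>C'>0. \<forall>k. Q (k + r) \<le> C' * Q k powr (a ^ r)"
proof (induction r)
  case 0
  have "Q k powr 1 = Q k" for k using assms(3)[of k] by simp
  then show ?case by (intro exI[of _ 1]) simp
next
  case (Suc r)
  then obtain C' where C': "C' > 0" "\<And>k. Q (k + r) \<le> C' * Q k powr (a ^ r)" by blast
  have "Q (k + Suc r) \<le> (C * C' powr a) * Q k powr (a ^ Suc r)" for k
  proof -
    have "Q (k + Suc r) \<le> C * Q (k + r) powr a" using assms(4)[of "k + r"] by simp
    also have "\<dots> \<le> C * (C' * Q k powr (a ^ r)) powr a"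
      using C'(2)[of k] assms(1,2) order_trans[OF zero_le_one assms(3)[of "k + r"]]
      by (intro mult_left_mono powr_mono2) auto
    also have "\<dots> = (C * C' powr a) * Q k powr (a ^ Suc r)"
      using C'(1) by (simp add: powr_mult powr_powr mult_ac)
    finally show ?thesis .
  qed
  then show ?case using assms(2) C'(1) by (intro exI[of _ "C * C' powr a"]) auto
qed

lemma powr_growth_exponential:
  fixes Q :: "nat \<Rightarrow> real"
  assumes "a \<ge> 1" "\<And>k. Q k \<ge> 1" "\<And>k. 4 * Q k powr a \<le> Q (Suc k)"
  shows "4 * Q k \<le> Q (Suc k)" "4 ^ k \<le> Q k"
proof -
  have step: "4 * Q k \<le> Q (Suc k)" for k
    using assms(3)[of k] powr_mono[OF assms(1) assms(2)[of k]] assms(2)[of k] by simp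
  then show "4 * Q k \<le> Q (Suc k)" .
  show "4 ^ k \<le> Q k"
  proof (induction k)
    case (Suc k)
    then show ?case using step[of k] by simp
  qed (simp add: assms(2))
qed

text \<open>The index \<open>k\<close> found here is the least one with \<open>4 \<bar>m\<bar> \<le> Q (k + d)\<close>. Then
  \<open>Q k powr a ^ (d - 1) \<le> Q (k + d - 1) < 4 \<bar>m\<bar>\<close>, and \<open>Q (k + d)\<close> is comparable to
  \<open>Q k powr a ^ d\<close>; the exponent \<open>b\<close> is the resulting surplus in both lower bounds.\<close>

lemma growth_window:
  fixes Q :: "nat \<Rightarrow> real"
  assumes a: "a > 1" and C: "C > 0" and Q1: "\<And>k. Q k \<ge> 1"
    and lower: "\<And>k. 4 * Q k powr a \<le> Q (Suc k)" and upper: "\<And>k. Q (Suc k) \<le> C * Q k powr a"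
    and d: "d \<ge> 1" and b: "b = 2 * a ^ (d - 1) - a ^ d - 1" "b > 0" and \<epsilon>: "\<epsilon> > 0"
  obtains N where "\<And>m. \<bar>m\<bar> > N \<Longrightarrow>
    \<exists>k. 16 * Q k * Q (k + d) \<le> m\<^sup>2 \<and> 4 * \<bar>m\<bar> \<le> Q (k + d) \<and>
      B \<le> m\<^sup>2 / (8 * Q (k + d) * Q k powr (1 + b - \<epsilon>))"
proof -
  obtain C' where C': "C' > 0" "\<And>k. Q (k + d) \<le> C' * Q k powr (a ^ d)"
    using powr_growth_upper[of a C Q d] a C Q1 upper by auto
  have low: "Q k powr (a ^ r) \<le> Q (k + r)" for k r
  proof (rule powr_growth_lower)
    show "Q k powr a \<le> Q (Suc k)" for k using lower[of k] powr_ge_zero[of "Q k" a] by linarith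
  qed (use a Q1 in auto)
  note expo = powr_growth_exponential[of a Q, OF less_imp_le[OF a] Q1 lower]
  have "Q k \<le> Q (Suc k)" for k using expo(1)[of k] Q1[of k] by linarith
  then have mono: "Q i \<le> Q j" if "i \<le> j" for i j using that by (rule lift_Suc_mono_le)
  have "real k \<le> Q k" for k
  proof -
    have "real k \<le> 2 ^ k" by (simp add: less_imp_le)
    also have "\<dots> \<le> 4 ^ k" by (intro power_mono) auto
    finally show ?thesis using expo(2)[of k] by linarith
  qed
  then have lim: "filterlim Q at_top sequentially"
    by (intro filterlim_at_top_mono[OF filterlim_real_sequentially] always_eventually) auto
  have powr_lim: "filterlim (\<lambda>k. Q k powr s) at_top sequentially" if "s > 0" for s
  proof -
    have "filterlim (\<lambda>k. exp (s * ln (Q k))) at_top sequentially"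
      using that by (intro filterlim_compose[OF exp_at_top] filterlim_compose[OF ln_at_top lim]
          filterlim_tendsto_pos_mult_at_top[OF tendsto_const])
    moreover have "Q k \<noteq> 0" for k using Q1[of k] by auto
    ultimately show ?thesis by (simp add: powr_def)
  qed
  have "\<forall>\<^sub>F k in sequentially. 256 * C' \<le> Q k powr b \<and> 128 * C' * B \<le> Q k powr \<epsilon>"
    using powr_lim[OF b(2)] powr_lim[OF \<epsilon>] unfolding filterlim_at_top by (intro eventually_conj) auto
  \<comment> \<open>256 = 16 * 16 and 128 = 8 * 16: the factors 16 and 8 of the two claims, times
    the 16 in the bound \<open>m2\<close> below.\<close>
  then obtain K where K: "\<And>k. k \<ge> K \<Longrightarrow> 256 * C' \<le> Q k powr b \<and> 128 * C' * B \<le> Q k powr \<epsilon>"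
    unfolding eventually_sequentially by blast
  show ?thesis
  proof (rule that)
    fix m assume m: "\<bar>m\<bar> > Q (K + d)"
    have "\<exists>p. 4 * \<bar>m\<bar> \<le> Q p"
      using lim unfolding filterlim_at_top eventually_sequentially by blast
    then obtain p where p: "4 * \<bar>m\<bar> \<le> Q p" "\<And>i. i < p \<Longrightarrow> \<not> 4 * \<bar>m\<bar> \<le> Q i"
      using exists_least_iff[of "\<lambda>p. 4 * \<bar>m\<bar> \<le> Q p"] by blast
    \<comment> \<open>Otherwise \<open>Q p \<le> Q (K + d) < \<bar>m\<bar>\<close>. This also keeps
      the subtraction \<open>p - d\<close> from truncating.\<close>
    have "p > K + d" using m p(1) mono[of p "K + d"] by force
    define k where "k = p - d"
    have k: "k \<ge> K" "p = k + d" using \<open>p > K + d\<close> by (auto simp: k_def)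
    define q where "q = Q k"
    have q: "q \<ge> 1" using Q1 by (simp add: q_def)
    have "q powr (a ^ (d - 1)) \<le> Q (k + (d - 1))" unfolding q_def by (rule low)
    also have "\<dots> \<le> 4 * \<bar>m\<bar>" using p(2)[of "k + (d - 1)"] k(2) d by auto
    finally have "(q powr (a ^ (d - 1)))\<^sup>2 \<le> (4 * \<bar>m\<bar>)\<^sup>2" by (intro power_mono) auto
    then have m2: "q powr (2 * a ^ (d - 1)) \<le> 16 * m\<^sup>2"
      by (simp only: power2_eq_square mult_2 powr_add)
    have Qkd: "Q (k + d) \<le> C' * q powr (a ^ d)" unfolding q_def by (rule C'(2))
    have "256 * q * Q (k + d) \<le> 256 * q * (C' * q powr (a ^ d))"
      using q Qkd by (intro mult_left_mono) auto
    also have "\<dots> = 256 * C' * (q powr 1 * q powr (a ^ d))" using q by simp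
    \<comment> \<open>The constant is absorbed by the surplus \<open>q powr b\<close>; by the choice
      of \<open>b\<close> the exponents then add up to \<open>2 * a ^ (d - 1)\<close>.\<close>
    also have "\<dots> \<le> q powr b * (q powr 1 * q powr (a ^ d))"
      using K[OF k(1)] by (intro mult_right_mono) (auto simp: q_def)
    also have "\<dots> = q powr (2 * a ^ (d - 1))"
      unfolding b(1) by (simp only: powr_add[symmetric]) simp
    finally have 1: "16 * q * Q (k + d) \<le> m\<^sup>2" using m2 by linarith
    have Q_pos: "Q (k + d) > 0" using Q1[of "k + d"] by linarith
    have "8 * Q (k + d) * q powr (1 + b - \<epsilon>) * B \<le> m\<^sup>2"
    \<comment> \<open>\<open>B\<close> is arbitrary, and the estimate multiplies inequalities by it.
      For positive \<open>B\<close> the surplus used is \<open>q powr \<epsilon>\<close>.\<close>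
    proof (cases "B \<le> 0")
      case True
      then have "8 * Q (k + d) * q powr (1 + b - \<epsilon>) * B \<le> 0"
        using Q_pos by (intro mult_nonneg_nonpos) auto
      then show ?thesis using zero_le_power2[of m] by linarith
    next
      case False
      have "128 * (Q (k + d) * q powr (1 + b - \<epsilon>) * B)
          \<le> 128 * (C' * q powr (a ^ d) * q powr (1 + b - \<epsilon>) * B)"
        using Qkd False by (intro mult_left_mono mult_right_mono) auto
      also have "\<dots> = 128 * C' * B * (q powr (a ^ d) * q powr (1 + b - \<epsilon>))" by simp
      also have "\<dots> \<le> q powr \<epsilon> * (q powr (a ^ d) * q powr (1 + b - \<epsilon>))"
        using K[OF k(1)] by (intro mult_right_mono) (auto simp: q_def)
      also have "\<dots> = q powr (2 * a ^ (d - 1))"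
        unfolding b(1) by (simp only: powr_add[symmetric]) simp
      finally show ?thesis using m2 by linarith
    qed
    then have "B \<le> m\<^sup>2 / (8 * Q (k + d) * q powr (1 + b - \<epsilon>))"
      using Q_pos q by (simp add: pos_le_divide_eq mult_ac)
    then show "\<exists>k. 16 * Q k * Q (k + d) \<le> m\<^sup>2 \<and> 4 * \<bar>m\<bar> \<le> Q (k + d) \<and>
        B \<le> m\<^sup>2 / (8 * Q (k + d) * Q k powr (1 + b - \<epsilon>))"
      using 1 p(1) k(2) unfolding q_def by blast
  qed
qed

section \<open>Divergence of the Birkhoff sums\<close>

text \<open>\<open>idx\<close> numbers the coordinates, as the class depends on their cyclic order.
  The summability conjunct ensures that \<open>phi_comp\<close> is a genuine sum and not a default
  value of \<open>suminf\<close>; the last filter expresses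
  \<open>\<bar>m\<bar> \<rightarrow> \<infinity>\<close>.\<close>

theorem theorem11:
  fixes a abar \<epsilon> :: real
    and \<alpha> :: "circle ^ 'd"
    and idx :: "nat \<Rightarrow> 'd::finite"
  assumes d: "CARD('d) \<ge> 3"
    and idx: "bij_betw idx {1..CARD('d)} UNIV"
    and a: "a > 1"
    and abar: "abar = 2 * a ^ (CARD('d) - 1) - a ^ CARD('d) - 1" "abar > 0"
    and \<epsilon>: "0 < \<epsilon>" "\<epsilon> < abar"
    and \<alpha>: "(\<lambda>j. \<alpha> $ idx j) \<in> class_C CARD('d) a"
    and minimal: "minimal_homeo (rotation \<alpha>)"
  shows "(\<forall>j x. summable (phi_term abar \<epsilon> (\<alpha> $ j) x)) \<and>
    class_Ck_torus (nat \<lceil>abar - \<epsilon>\<rceil>) (phi abar \<epsilon> \<alpha>) \<and>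
    (\<forall>x. (\<forall>j. x $ j \<in> F_set (\<alpha> $ j)) \<longrightarrow>
      filterlim (\<lambda>m::int. birkhoff_sum (rotation \<alpha>) (phi abar \<epsilon> \<alpha>) m x)
        at_top (filtercomap abs at_top))"
proof -
  define D where "D = CARD('d)"
  have D: "D \<ge> 3" using d by (simp add: D_def)
  have "\<forall>j. \<exists>t. \<alpha> $ j = to_circle t" by (metis to_circle_surj)
  then obtain A where A: "\<And>j. \<alpha> $ j = to_circle (A j)" by metis
  have \<alpha>_eq: "\<alpha> = (\<chi> j. to_circle (A j))" by (simp add: vec_eq_iff A)
  have idx_ex: "\<exists>i<D. j = idx (Suc i)" for j
  proof -
    obtain i where "i \<in> {1..D}" "j = idx i"
      using idx by (metis D_def UNIV_I bij_betw_imp_surj_on imageE)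
    then show ?thesis by (intro exI[of _ "i - 1"]) auto
  qed
  have irr: "A j \<notin> \<rat>" for j
    using idx_ex[of j] \<alpha> by (auto simp: class_C_def D_def A irrational_circle.abs_eq)
  define C where "C = real_of_int (2 * \<lceil>4 powr (a + 2)\<rceil>)"
  have "4 powr (a + 2) > 0" by simp
  then have "C > 0" unfolding C_def by linarith
  \<comment> \<open>Row by row: all angles at index 1, then all at index 2, and so on. Hence
    \<open>Q (k + D)\<close> is the denominator following \<open>Q k\<close> for the same
    angle.\<close>
  define Q where "Q k = real (cf_denom (\<alpha> $ idx (Suc (k mod D))) (Suc (k div D)))" for k
  have denom_pos: "cf_denom (\<alpha> $ j) n \<ge> 1" for j n
    using cf_denom_real_pos[OF irr, of j n] by (simp add: A cf_denom.abs_eq)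
  have Q1: "Q k \<ge> 1" for k
    using denom_pos by (simp add: Q_def)
  have Q_eq: "Q (n * D + i) = real (cf_denom (\<alpha> $ idx (Suc i)) (Suc n))" if "i < D" for n i
    using that by (simp add: Q_def)
  have Q_add: "Q (k + D) = real (cf_denom (\<alpha> $ idx (Suc (k mod D))) (Suc (Suc (k div D))))" for k
    using D by (simp add: Q_def)
  have step: "4 * Q k powr a \<le> Q (Suc k) \<and> Q (Suc k) \<le> C * Q k powr a" for k
  proof -
    let ?\<alpha> = "\<lambda>j. \<alpha> $ idx j" and ?j = "Suc (k mod D)" and ?n = "Suc (k div D)"
    have mod: "k mod D < D" using D by simp
    then have "?j \<in> {1..D}" by simp
    then have "4 * real (cf_denom_cyclic D ?\<alpha> ?j ?n) powr a \<le> real (cf_denom_cyclic D ?\<alpha> (?j + 1) ?n) \<and>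
        real (cf_denom_cyclic D ?\<alpha> (?j + 1) ?n) \<le> C * real (cf_denom_cyclic D ?\<alpha> ?j ?n) powr a"
      using \<alpha> unfolding class_C_def D_def[symmetric] C_def[symmetric] by auto
    moreover have "real (cf_denom_cyclic D ?\<alpha> ?j ?n) = Q k"
      using mod by (auto simp: cf_denom_cyclic_def Q_def)
    \<comment> \<open>At the end of a row, the convention for \<open>j = d + 1\<close> is exactly
      the passage to the next row.\<close>
    moreover have "real (cf_denom_cyclic D ?\<alpha> (?j + 1) ?n) = Q (Suc k)"
      using D by (auto simp: cf_denom_cyclic_def Q_def mod_Suc div_Suc)
    ultimately show ?thesis by simp
  qed
  then have lower: "4 * Q k powr a \<le> Q (Suc k)" and upper: "Q (Suc k) \<le> C * Q k powr a" for k
    by auto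
  have growth: "4 ^ n \<le> real (cf_denom (to_circle (A j)) (Suc n))" for j n
  proof -
    obtain i where i: "i < D" "j = idx (Suc i)" using idx_ex by blast
    have "n \<le> n * D + i" using mult_le_mono2[of 1 D n] D by linarith
    then have "(4::real) ^ n \<le> 4 ^ (n * D + i)" by (rule power_increasing) simp
    also have "\<dots> \<le> Q (n * D + i)"
      by (rule powr_growth_exponential(2)[of a]) (use a Q1 lower in auto)
    finally show ?thesis using Q_eq[OF i(1)] i(2) by (simp add: A)
  qed

  \<comment> \<open>Summability and smoothness\<close>
  define \<kappa> where "\<kappa> = nat \<lceil>abar - \<epsilon>\<rceil>"
  \<comment> \<open>The ceiling is positive because \<open>\<epsilon> < abar\<close>, so
    \<open>nat\<close> does not truncate.\<close>
  have \<kappa>: "real \<kappa> < 1 + abar - \<epsilon>" using \<epsilon> unfolding \<kappa>_def by linarith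
  have "\<exists>H. H 0 = (\<lambda>t. phi_comp abar \<epsilon> (to_circle (A j)) (to_circle t)) \<and>
      (\<forall>i t. i < \<kappa> \<longrightarrow> (H i has_real_derivative H (Suc i) t) (at t)) \<and>
      continuous_on UNIV (H \<kappa>) \<and>
      (\<forall>t. summable (phi_term abar \<epsilon> (to_circle (A j)) (to_circle t)))" for j
    by (rule phi_comp_derivatives[OF irr growth \<kappa>]) blast
  then obtain H where H: "\<And>j. H j 0 = (\<lambda>t. phi_comp abar \<epsilon> (to_circle (A j)) (to_circle t))"
      "\<And>j i t. i < \<kappa> \<Longrightarrow> (H j i has_real_derivative H j (Suc i) t) (at t)"
      "\<And>j. continuous_on UNIV (H j \<kappa>)"
      "\<And>j t. summable (phi_term abar \<epsilon> (to_circle (A j)) (to_circle t))"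
    by metis
  have summable_phi: "summable (phi_term abar \<epsilon> (\<alpha> $ j) x)" for j x
    using H(4) A by (metis to_circle_surj)
  have smooth: "class_Ck_torus \<kappa> (phi abar \<epsilon> \<alpha>)"
    using class_Ck_sum_components[of \<kappa> H "\<lambda>_. 1"] H(2,3)
    by (simp add: class_Ck_torus_def phi_def H(1) A)

  \<comment> \<open>Divergence at the points of \<open>F_set\<close>\<close>
  have "filterlim (\<lambda>m. birkhoff_sum (rotation \<alpha>) (phi abar \<epsilon> \<alpha>) m x) at_top (filtercomap abs at_top)"
    if F: "\<forall>j. x $ j \<in> F_set (\<alpha> $ j)" for x
  proof -
    have "\<forall>j. \<exists>t. x $ j = to_circle t" by (metis to_circle_surj)
    then obtain X where X: "\<And>j. x $ j = to_circle (X j)" by metis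
    have x_eq: "x = (\<chi> j. to_circle (X j))" by (simp add: vec_eq_iff X)
    have XF: "to_circle (X j) \<in> F_set (to_circle (A j))" for j using F X A by metis
    have pos: "cf_denom (to_circle (A j)) n > 0" for j n
      using denom_pos[of j n] by (simp add: A)
    define f where "f j k n = f_bump abar \<epsilon> (to_circle (A j)) (Suc n) (to_circle (X j + of_int k * A j))"
      for j and k :: int and n
    define G where "G k = (\<Sum>j\<in>UNIV. \<Sum>n. f j k n)" for k
    have f_step: "f j (k + 1) n - f j k n
        = phi_term abar \<epsilon> (to_circle (A j)) (to_circle (X j + of_int k * A j)) n" for j k n
      by (simp add: f_def phi_term_def to_circle_add algebra_simps)
    have f_0: "summable (f j 0)" for j
    proof (rule summable_comparison_test')
      show "summable (\<lambda>n. 2 * pi\<^sup>2 * real (cf_denom (to_circle (A j)) (Suc n)) powr (\<epsilon> - abar))"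
        using \<epsilon> by (intro summable_mult summable_powr_geometric growth) auto
      show "norm (f j 0 n) \<le> 2 * pi\<^sup>2 * real (cf_denom (to_circle (A j)) (Suc n)) powr (\<epsilon> - abar)" for n
        using f_bump_le_on_F_set[OF XF pos pos] f_bump_nonneg by (simp add: f_def)
    qed
    have f_diff: "summable (\<lambda>n. f j (k + 1) n - f j k n)" for j k
      unfolding f_step by (rule H(4))
    \<comment> \<open>Convergence at time 0 spreads to all times in both directions, since
      consecutive times differ by the summable series of \<open>phi_term\<close>.\<close>
    have f_summable: "summable (f j k)" for j k
    proof (induction k rule: int_induct[where k = 0])
      case base
      show ?case by (rule f_0)
    next
      case (step1 i)
      show ?case using summable_add[OF f_diff[of j i] step1(2)] by simp
    next
      case (step2 i)
      show ?case using summable_diff[OF step2(2) f_diff[of j "i - 1"]] by simp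
    qed
    have phi_step: "phi_comp abar \<epsilon> (to_circle (A j)) (to_circle (X j + of_int k * A j))
        = suminf (f j (k + 1)) - suminf (f j k)" for j k
      by (simp only: phi_comp_def suminf_diff[OF f_summable f_summable] f_step)
    have cobound: "birkhoff_sum (rotation \<alpha>) (phi abar \<epsilon> \<alpha>) m x = G m - G 0" for m
    proof (rule birkhoff_sum_coboundary)
      show "phi abar \<epsilon> \<alpha> (int_iterate (rotation \<alpha>) k x) = G (k + 1) - G k" for k
        unfolding \<alpha>_eq x_eq int_iterate_rotation G_def phi_def
        by (simp add: phi_step sum_subtractf)
    qed
    have G_ge: "f j k n \<le> G k" for j k n
    proof -
      have nonneg: "f j k n \<ge> 0" for j n by (simp add: f_def f_bump_nonneg)
      have "f j k n \<le> (\<Sum>n. f j k n)"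
        using sum_le_suminf[OF f_summable, of "{n}" j k] nonneg by simp
      also have "\<dots> \<le> G k"
        unfolding G_def by (rule member_le_sum) (auto intro!: suminf_nonneg f_summable nonneg)
      finally show ?thesis .
    qed
    show ?thesis
      unfolding filterlim_at_top eventually_filtercomap
    proof
      fix Z
      \<comment> \<open>The threshold is \<open>Z + G 0\<close> because the Birkhoff sum is
        \<open>G m - G 0\<close>.\<close>
      obtain N where N: "\<And>m. \<bar>m\<bar> > N \<Longrightarrow>
          \<exists>k. 16 * Q k * Q (k + D) \<le> m\<^sup>2 \<and> 4 * \<bar>m\<bar> \<le> Q (k + D) \<and>
            Z + G 0 \<le> m\<^sup>2 / (8 * Q (k + D) * Q k powr (1 + abar - \<epsilon>))"
        using growth_window[of a C Q D abar \<epsilon> "Z + G 0", OF a \<open>C > 0\<close> Q1 lower upper]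
          D abar \<epsilon>(1) unfolding D_def by auto
      have "Z \<le> birkhoff_sum (rotation \<alpha>) (phi abar \<epsilon> \<alpha>) m x" if "\<bar>m\<bar> > \<lceil>N\<rceil>" for m
      proof -
        have "\<bar>real_of_int m\<bar> > N" using that by linarith
        then obtain k where k: "16 * Q k * Q (k + D) \<le> (real_of_int m)\<^sup>2"
            "4 * \<bar>real_of_int m\<bar> \<le> Q (k + D)"
            "Z + G 0 \<le> (real_of_int m)\<^sup>2 / (8 * Q (k + D) * Q k powr (1 + abar - \<epsilon>))"
          using N by blast
        \<comment> \<open>The position \<open>k\<close> selects the angle and the index of one bump
          that alone exceeds the threshold; the other bumps are non-negative.\<close>
        let ?j = "idx (Suc (k mod D))"
        have "Z + G 0 \<le> f ?j m (k div D)"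
          using k(3) f_bump_ge_on_F_set[where n = "k div D" and m = m and b = abar and \<epsilon> = \<epsilon>,
              OF irr[of ?j] XF[of ?j]] k(1,2)
          by (simp add: f_def Q_add Q_def[of k] A)
        then show ?thesis using G_ge[of ?j m "k div D"] unfolding cobound by linarith
      qed
      then show "\<exists>P. eventually P at_top \<and> (\<forall>m. P \<bar>m\<bar> \<longrightarrow> Z \<le> birkhoff_sum (rotation \<alpha>) (phi abar \<epsilon> \<alpha>) m x)"
        using eventually_gt_at_top[of "\<lceil>N\<rceil>"] by blast
    qed
  qed
  then show ?thesis using summable_phi smooth unfolding \<kappa>_def by blast
qed

end
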